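(* Let $N\ge 2$ and $K\ge 1$ be integers, let $\alpha_k,\beta_k,\delta_k>0$ for $k=1,\dots,K$, and let $x(t)$ be the inhomogeneous symmetric simple exclusion process with open boundaries on $G=\{0,1,\dots,K\}^N$ with these rates. Then $x(t)$ has a product-form stationary distribution: $$p(x_1,\dots,x_N)=\prod_{i=1}^N P_i(x_i)\quad\text{for all }(x_1,\dots,x_N)\in G.$$
   Context: The process: $x(t)=(x_1(t),\dots,x_N(t))$, $t\ge0$, is a continuous-time Markov chain with finite state space $G=\{0,1,\dots,K\}^N$. Sites are numbered $1,\dots,N$ from left to right; $x_i=0$ means that site $i$ is vacant, and $x_i=k\in\{1,\dots,K\}$ means that site $i$ is occupied by a particle of type $k$. The transitions and their rates are, for each $k=1,\dots,K$: (arrival) for $i=1$ and for $i=N$, if $x_i=0$, then $x_i$ changes to $k$ at rate $\alpha_k$ (a particle of type $k$ enters from outside); (departure) for $i=1$ and for $i=N$, if $x_i=k$, then $x_i$ changes to $0$ at rate $\beta_k$ (the particle leaves the system); (hop) for any two adjacent sites $i,j\in\{1,\dots,N\}$, $|i-j|=1$, if $x_i=k$ and $x_j=0$, then the particle in site $i$ moves to site $j$ (so $x_i$ becomes $0$ and $x_j$ becomes $k$) at rate $\delta_k$. No other transitions occur. Steady probabilities: $p(x_1,\dots,x_N)$ denotes the steady (limiting as $t\to\infty$, equivalently stationary) probability of the state $(x_1,\dots,x_N)\in G$, and $P_i(a)$ denotes the steady probability that site $i$ is in state $a\in\{0,1,\dots,K\}$, i.e. the probability of $\{x_i=a\}$ under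 the stationary distribution $p$. *)

theory Defs
  imports "HOL-Probability.Probability"
begin

text \<open>
  A continuous-time Markov chain on a finite state space \<open>S\<close> is given by its jump rates
  \<open>q x y\<close> for \<open>x \<noteq> y\<close>. Its generator is \<open>Q\<close> and its transition function
  is \<open>P t = exp (t Q)\<close>, i.e. \<open>P t x y\<close> is the probability of being in \<open>y\<close>
  at time \<open>t\<close> when started in \<open>x\<close>.
\<close>

definition generator :: "'s set \<Rightarrow> ('s \<Rightarrow> 's \<Rightarrow> real) \<Rightarrow> 's \<Rightarrow> 's \<Rightarrow> real" where
  "generator S q x y = (if x = y then - (\<Sum>z\<in>S - {x}. q x z) else q x y)"

primrec kernel_power :: "'s set \<Rightarrow> ('s \<Rightarrow> 's \<Rightarrow> real) \<Rightarrow> nat \<Rightarrow> 's \<Rightarrow> 's \<Rightarrow> real" where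
  "kernel_power S Q 0 = (\<lambda>x y. if x = y then 1 else 0)"
| "kernel_power S Q (Suc n) = (\<lambda>x y. \<Sum>z\<in>S. Q x z * kernel_power S Q n z y)"

definition transition_function ::
    "'s set \<Rightarrow> ('s \<Rightarrow> 's \<Rightarrow> real) \<Rightarrow> real \<Rightarrow> 's \<Rightarrow> 's \<Rightarrow> real" where
  "transition_function S q t x y = (\<Sum>n. t ^ n / fact n * kernel_power S (generator S q) n x y)"

definition stationary_distribution ::
    "'s set \<Rightarrow> ('s \<Rightarrow> 's \<Rightarrow> real) \<Rightarrow> 's pmf \<Rightarrow> bool" where
  "stationary_distribution S q p \<longleftrightarrow>
     set_pmf p \<subseteq> S \<and>
     (\<forall>t\<ge>0. \<forall>y\<in>S. (\<Sum>x\<in>S. pmf p x * transition_function S q t x y) = pmf p y)"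

definition exclusion_states :: "nat \<Rightarrow> nat \<Rightarrow> (nat \<Rightarrow> nat) set" where
  "exclusion_states N K = {1..N} \<rightarrow>\<^sub>E {0..K}"

text \<open>
  The rate from \<open>x\<close> to \<open>y\<close> is the total rate of the arrivals, departures and hops that turn
  \<open>x\<close> into \<open>y\<close>.
\<close>

definition exclusion_rate ::
    "nat \<Rightarrow> nat \<Rightarrow> (nat \<Rightarrow> real) \<Rightarrow> (nat \<Rightarrow> real) \<Rightarrow> (nat \<Rightarrow> real) \<Rightarrow>
     (nat \<Rightarrow> nat) \<Rightarrow> (nat \<Rightarrow> nat) \<Rightarrow> real" where
  "exclusion_rate N K \<alpha> \<beta> \<delta> x y =
     (\<Sum>k\<in>{1..K}.
        (\<Sum>i\<in>{1, N}. if x i = 0 \<and> y = x(i := k) then \<alpha> k else 0)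
      + (\<Sum>i\<in>{1, N}. if x i = k \<and> y = x(i := 0) then \<beta> k else 0)
      + (\<Sum>(i, j)\<in>{(i, j). i \<in> {1..N} \<and> j \<in> {1..N} \<and> \<bar>int i - int j\<bar> = 1}.
           if x i = k \<and> x j = 0 \<and> y = x(i := 0, j := k) then \<delta> k else 0))"

definition site_prob :: "(nat \<Rightarrow> nat) pmf \<Rightarrow> nat \<Rightarrow> nat \<Rightarrow> real" where
  "site_prob p i a = measure_pmf.prob p {x. x i = a}"

end

theory Submission
  imports Defs
begin

text \<open>
  Give each site the law proportional to \<open>1\<close> for a vacancy and \<open>\<alpha> k / \<beta> k\<close> for a particle of
  type \<open>k\<close>. The product of these laws is reversible: arrivals balance departures, and a hop
  permutes the factors and has the same rate in both directions. Since the empty configuration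
  is reachable from everywhere, no other distribution is stationary, and the factors of the
  product are its marginals.
\<close>

section \<open>Stationarity in terms of the generator\<close>

text \<open>Any geometric bound makes the exponential series converge. The sum of all absolute
  entries serves because it dominates every absolute row sum, so each further factor costs at most
  one more power.\<close>

lemma kernel_power_bound:
  assumes "finite S" "x \<in> S"
  shows "\<bar>kernel_power S Q n x y\<bar> \<le> (\<Sum>u\<in>S. \<Sum>v\<in>S. \<bar>Q u v\<bar>) ^ n"
  using assms(2)
proof (induction n arbitrary: x)
  case 0
  then show ?case by simp
next
  case (Suc n)
  let ?M = "\<Sum>u\<in>S. \<Sum>v\<in>S. \<bar>Q u v\<bar>"
  have M: "0 \<le> ?M" by (intro sum_nonneg) auto
  have "\<bar>kernel_power S Q (Suc n) x y\<bar> \<le> (\<Sum>z\<in>S. \<bar>Q x z * kernel_power S Q n z y\<bar>)"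
    by simp
  also have "\<dots> \<le> (\<Sum>z\<in>S. \<bar>Q x z\<bar> * ?M ^ n)"
    using Suc.IH by (intro sum_mono) (auto simp: abs_mult intro!: mult_left_mono)
  also have "\<dots> = (\<Sum>z\<in>S. \<bar>Q x z\<bar>) * ?M ^ n"
    by (simp add: sum_distrib_right)
  also have "\<dots> \<le> ?M * ?M ^ n"
    using Suc.prems M \<open>finite S\<close>
    by (intro mult_right_mono member_le_sum[where f = "\<lambda>u. \<Sum>v\<in>S. \<bar>Q u v\<bar>"])
       (auto intro: sum_nonneg)
  finally show ?case by simp
qed

lemma summable_kernel_power:
  assumes "finite S" "x \<in> S"
  shows "summable (\<lambda>n. t ^ n / fact n * kernel_power S Q n x y)"
proof -
  let ?M = "\<Sum>u\<in>S. \<Sum>v\<in>S. \<bar>Q u v\<bar>"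
  have "summable (\<lambda>n. inverse (fact n) * (\<bar>t\<bar> * ?M) ^ n)"
    by (rule summable_exp)
  then show ?thesis
  proof (rule summable_comparison_test'[where N = 0])
    fix n :: nat
    have "\<bar>t ^ n / fact n * kernel_power S Q n x y\<bar>
        = \<bar>t\<bar> ^ n / fact n * \<bar>kernel_power S Q n x y\<bar>"
      by (simp add: abs_mult power_abs)
    also have "\<dots> \<le> \<bar>t\<bar> ^ n / fact n * ?M ^ n"
      by (intro mult_left_mono kernel_power_bound assms) auto
    finally show "norm (t ^ n / fact n * kernel_power S Q n x y)
        \<le> inverse (fact n) * (\<bar>t\<bar> * ?M) ^ n"
      by (simp add: power_mult_distrib field_simps)
  qed
qed

text \<open>The evolved mass at \<open>y\<close> is a power series in \<open>t\<close> with linear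
  coefficient \<open>pQ\<close>. If it is constant, its derivative at 0 vanishes; conversely
  \<open>pQ = 0\<close> kills every coefficient after the constant one.\<close>

lemma stationary_distribution_iff_generator:
  assumes "finite S"
  shows "stationary_distribution S q p \<longleftrightarrow>
    set_pmf p \<subseteq> S \<and> (\<forall>y\<in>S. (\<Sum>x\<in>S. pmf p x * generator S q x y) = 0)"
proof -
  let ?Q = "generator S q"
  \<comment> \<open>The coefficient of \<open>t ^ n\<close> in the mass at \<open>y\<close> after
    \<open>p\<close> has evolved for time \<open>t\<close>.\<close>
  define c where "c y n = (\<Sum>x\<in>S. pmf p x * kernel_power S ?Q n x y) / fact n" for y n
  \<comment> \<open>Exchanging the sums puts one generator factor next to \<open>p\<close>, so that
    \<open>pQ\<close> appears in every later coefficient.\<close>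
  have c_Suc: "c y (Suc n) =
      (\<Sum>z\<in>S. (\<Sum>x\<in>S. pmf p x * ?Q x z) * kernel_power S ?Q n z y) / fact (Suc n)" for y n
    unfolding c_def kernel_power.simps sum_distrib_left sum_distrib_right
    by (subst sum.swap) (simp add: mult.assoc)
  have c0: "c y 0 = pmf p y" if "y \<in> S" for y
  proof -
    have "c y 0 = (\<Sum>x\<in>S. if x = y then pmf p x else 0)"
      unfolding c_def by (simp, intro sum.cong) auto
    then show ?thesis using that assms by simp
  qed
  have c1: "c y (Suc 0) = (\<Sum>x\<in>S. pmf p x * ?Q x y)" if "y \<in> S" for y
  proof -
    have "c y (Suc 0) = (\<Sum>z\<in>S. if z = y then \<Sum>x\<in>S. pmf p x * ?Q x z else 0)"
      unfolding c_Suc by (simp, intro sum.cong) auto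
    then show ?thesis using that assms by simp
  qed
  have sums: "(\<lambda>n. c y n * t ^ n) sums (\<Sum>x\<in>S. pmf p x * transition_function S q t x y)" for y t
  proof -
    have "(\<lambda>n. \<Sum>x\<in>S. pmf p x * (t ^ n / fact n * kernel_power S ?Q n x y)) sums
        (\<Sum>x\<in>S. pmf p x * transition_function S q t x y)"
      unfolding transition_function_def
      by (intro sums_sum sums_mult summable_sums summable_kernel_power assms)
    moreover have "(\<Sum>x\<in>S. pmf p x * (t ^ n / fact n * kernel_power S ?Q n x y)) = c y n * t ^ n"
      for n
      unfolding c_def sum_divide_distrib sum_distrib_right
      by (intro sum.cong) auto
    ultimately show ?thesis by simp
  qed
  have flow: "(\<forall>t\<ge>0. (\<Sum>x\<in>S. pmf p x * transition_function S q t x y) = pmf p y)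
      \<Longrightarrow> (\<Sum>x\<in>S. pmf p x * ?Q x y) = 0" if y: "y \<in> S" for y
  proof -
    assume const: "\<forall>t\<ge>0. (\<Sum>x\<in>S. pmf p x * transition_function S q t x y) = pmf p y"
    have "((\<lambda>t. \<Sum>n. c y n * t ^ n) has_field_derivative (\<Sum>n. diffs (c y) n * 0 ^ n)) (at 0)"
      by (rule termdiffs_strong[where K = 1]) (use sums[of y 1] in \<open>auto simp: sums_iff\<close>)
    then have "((\<lambda>t. \<Sum>n. c y n * t ^ n) has_field_derivative c y (Suc 0)) (at 0 within {0..})"
      by (intro has_field_derivative_at_within[where s = "{0..}"]) (simp add: diffs_def)
    \<comment> \<open>Constancy is known only for \<open>t \<ge> 0\<close>, so both derivatives are
      taken within the half-line; they agree because 0 is not isolated there.\<close>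
    moreover have "((\<lambda>t. \<Sum>n. c y n * t ^ n) has_field_derivative 0) (at 0 within {0..})"
    unfolding has_field_derivative_def
    proof (rule has_derivative_transform[where f = "\<lambda>_. pmf p y"])
      fix t :: real
      assume "t \<in> {0..}"
      then show "(\<Sum>n. c y n * t ^ n) = pmf p y"
        using const sums[of y t] by (simp add: sums_iff)
    qed (auto simp flip: has_field_derivative_def)
    moreover have "at (0::real) within {0..} \<noteq> bot"
      by (simp add: at_within_Ici_at_right)
    ultimately have "c y (Suc 0) = 0"
      by (metis has_field_derivative_unique)
    then show ?thesis using c1[OF y] by simp
  qed
  have conv: "(\<Sum>x\<in>S. pmf p x * transition_function S q t x y) = pmf p y"
    if Q: "\<forall>y\<in>S. (\<Sum>x\<in>S. pmf p x * ?Q x y) = 0" and y: "y \<in> S" for y t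
  proof -
    have "c y (Suc n) = 0" for n
      unfolding c_Suc using Q by simp
    then have "c y n * t ^ n = (if n = 0 then pmf p y else 0)" for n
      using c0[OF y] by (cases n) auto
    then have "(\<lambda>n. c y n * t ^ n) sums pmf p y"
      using sums_single[of 0 "\<lambda>_. pmf p y"] by simp
    then show ?thesis using sums sums_unique2 by blast
  qed
  show ?thesis
    unfolding stationary_distribution_def using flow conv by blast
qed

section \<open>Uniqueness for reversible chains\<close>

text \<open>Splitting off the diagonal entry leaves inflow minus outflow at \<open>y\<close>, a form
  in which detailed balance cancels term by term.\<close>

lemma sum_generator:
  assumes "finite S" "y \<in> S"
  shows "(\<Sum>x\<in>S. f x * generator S q x y) = (\<Sum>x\<in>S - {y}. f x * q x y - f y * q y x)"
proof -
  have "(\<Sum>x\<in>S. f x * generator S q x y)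
      = f y * generator S q y y + (\<Sum>x\<in>S - {y}. f x * generator S q x y)"
    using assms by (rule sum.remove)
  also have "(\<Sum>x\<in>S - {y}. f x * generator S q x y) = (\<Sum>x\<in>S - {y}. f x * q x y)"
    by (intro sum.cong) (auto simp: generator_def)
  finally show ?thesis
    by (simp add: generator_def sum_subtractf sum_distrib_left)
qed

text \<open>At a maximum point the harmonic sum consists of terms of one sign adding up to zero, so
  every jump of positive rate leads to another maximum point. Following a path to \<open>z\<close>
  carries the maximum there.\<close>

lemma maximum_principle:
  fixes f :: "'s \<Rightarrow> real"
  assumes "finite S"
    and nonneg: "\<And>x y. x \<in> S \<Longrightarrow> y \<in> S \<Longrightarrow> 0 \<le> q x y"
    and harmonic: "\<And>x. x \<in> S \<Longrightarrow> (\<Sum>y\<in>S - {x}. q x y * (f y - f x)) = 0"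
    and reach: "\<And>x. x \<in> S \<Longrightarrow> (x, z) \<in> {(x, y). x \<in> S \<and> y \<in> S \<and> 0 < q x y}\<^sup>*"
    and "x \<in> S"
  shows "f x \<le> f z"
proof -
  define m where "m = Max (f ` S)"
  have le: "f y \<le> m" if "y \<in> S" for y
    using that \<open>finite S\<close> by (simp add: m_def)
  have step: "f y = m" if "x \<in> S" "y \<in> S" "0 < q x y" "f x = m" for x y
  proof (cases "x = y")
    case False
    have "(\<Sum>y\<in>S - {x}. q x y * (m - f y)) = - (\<Sum>y\<in>S - {x}. q x y * (f y - f x))"
      by (simp add: sum_negf[symmetric] right_diff_distrib that)
    also have "\<dots> = 0" using harmonic[OF that(1)] that(4) by simp
    finally have "(\<Sum>y\<in>S - {x}. q x y * (m - f y)) = 0" .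
    moreover have "0 \<le> q x y * (m - f y)" if "y \<in> S - {x}" for y
      using that le nonneg \<open>x \<in> S\<close> by auto
    ultimately have "\<forall>y\<in>S - {x}. q x y * (m - f y) = 0"
      using \<open>finite S\<close> by (subst (asm) sum_nonneg_eq_0_iff) auto
    then have "q x y * (m - f y) = 0" using that(2) False by blast
    then show ?thesis using that(3) by simp
  qed (use that in simp)
  obtain x0 where x0: "x0 \<in> S" "f x0 = m"
    using Max_in[of "f ` S"] assms(1,5) unfolding m_def by fastforce
  have "f z = m"
    using reach[OF x0(1)] by (induction rule: rtrancl_induct) (use x0 step in auto)
  then show ?thesis using le[OF \<open>x \<in> S\<close>] by simp
qed

text \<open>
  By detailed balance the density of a stationary distribution with respect to \<open>r\<close> is
  harmonic, so it attains both its maximum and its minimum at \<open>z\<close>.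
\<close>

lemma reversible_stationary_iff:
  assumes "finite S" and "set_pmf r = S"
    and nonneg: "\<And>x y. x \<in> S \<Longrightarrow> y \<in> S \<Longrightarrow> 0 \<le> q x y"
    and balance: "\<And>x y. x \<in> S \<Longrightarrow> y \<in> S \<Longrightarrow> pmf r x * q x y = pmf r y * q y x"
    and reach: "\<And>x. x \<in> S \<Longrightarrow> (x, z) \<in> {(x, y). x \<in> S \<and> y \<in> S \<and> 0 < q x y}\<^sup>*"
  shows "stationary_distribution S q p \<longleftrightarrow> p = r"
proof
  assume "p = r"
  moreover have "(\<Sum>x\<in>S - {y}. pmf r x * q x y - pmf r y * q y x) = 0" if "y \<in> S" for y
    using balance that by (intro sum.neutral) auto
  ultimately show "stationary_distribution S q p"
    using assms(1,2) by (auto simp: stationary_distribution_iff_generator sum_generator)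
next
  assume "stationary_distribution S q p"
  then have p: "set_pmf p \<subseteq> S"
    and flow: "\<And>y. y \<in> S \<Longrightarrow> (\<Sum>x\<in>S - {y}. pmf p x * q x y - pmf p y * q y x) = 0"
    using \<open>finite S\<close> by (auto simp: stationary_distribution_iff_generator sum_generator)
  define f where "f x = pmf p x / pmf r x" for x
  have r_pos: "0 < pmf r x" if "x \<in> S" for x
    using that assms(2) by (simp add: pmf_positive)
  have p_eq: "pmf p x = pmf r x * f x" if "x \<in> S" for x
    using r_pos[OF that] by (simp add: f_def)
  have harmonic: "(\<Sum>y\<in>S - {x}. q x y * (f y - f x)) = 0" if "x \<in> S" for x
  proof -
    \<comment> \<open>Weighted by the positive \<open>pmf r x\<close>, the sum becomes the net flow
      of \<open>p\<close> into \<open>x\<close>: detailed balance trades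
      \<open>pmf r x * q x y\<close> for \<open>pmf r y * q y x\<close>.\<close>
    have "pmf r x * (\<Sum>y\<in>S - {x}. q x y * (f y - f x))
        = (\<Sum>y\<in>S - {x}. pmf p y * q y x - pmf p x * q x y)"
      unfolding sum_distrib_left
    proof (intro sum.cong refl)
      fix y assume "y \<in> S - {x}"
      then have "pmf p y * q y x - pmf p x * q x y
          = (pmf r y * q y x) * f y - (pmf r x * q x y) * f x"
        using p_eq that by simp
      also have "pmf r y * q y x = pmf r x * q x y"
        using balance that \<open>y \<in> S - {x}\<close> by auto
      finally show "pmf r x * (q x y * (f y - f x)) = pmf p y * q y x - pmf p x * q x y"
        by (simp add: algebra_simps)
    qed
    also have "\<dots> = 0" using flow[OF that] .
    finally show ?thesis using r_pos[OF that] by simp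
  qed
  have "f x = f z" if "x \<in> S" for x
  proof (rule antisym)
    show "f x \<le> f z"
      using \<open>finite S\<close> nonneg harmonic reach that by (rule maximum_principle)
    \<comment> \<open>The lower bound is the maximum principle for \<open>- f\<close>, which is
      harmonic as well.\<close>
    have "(\<Sum>y\<in>S - {x}. q x y * (- f y - - f x)) = 0" if "x \<in> S" for x
    proof -
      have "(\<Sum>y\<in>S - {x}. q x y * (- f y - - f x)) = - (\<Sum>y\<in>S - {x}. q x y * (f y - f x))"
        by (simp add: sum_negf[symmetric] algebra_simps)
      then show ?thesis using harmonic[OF that] by simp
    qed
    then have "- f x \<le> - f z"
      using maximum_principle[OF \<open>finite S\<close> nonneg _ reach that, of "\<lambda>x. - f x"] by auto
    then show "f z \<le> f x" by simp
  qed
  then have pf: "pmf p x = pmf r x * f z" if "x \<in> S" for x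
    using p_eq that by simp
  \<comment> \<open>Comparing total masses fixes the constant density at 1.\<close>
  then have "(\<Sum>x\<in>S. pmf p x) = (\<Sum>x\<in>S. pmf r x) * f z"
    by (simp add: sum_distrib_right)
  moreover have "(\<Sum>x\<in>S. pmf p x) = 1" "(\<Sum>x\<in>S. pmf r x) = 1"
    using \<open>finite S\<close> p assms(2) by (auto intro: sum_pmf_eq_1)
  ultimately have "f z = 1" by simp
  show "p = r"
  proof (rule pmf_eqI)
    fix x
    show "pmf p x = pmf r x"
      using pf[of x] \<open>f z = 1\<close> p assms(2) by (cases "x \<in> S") (auto simp: set_pmf_iff subset_iff)
  qed
qed

section \<open>State space, rates and reachability of the exclusion process\<close>

lemma finite_exclusion_states: "finite (exclusion_states N K)"
  by (simp add: exclusion_states_def finite_PiE)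

lemma exclusion_rate_nonneg:
  assumes "\<And>k. k \<in> {1..K} \<Longrightarrow> 0 \<le> \<alpha> k" "\<And>k. k \<in> {1..K} \<Longrightarrow> 0 \<le> \<beta> k"
    and "\<And>k. k \<in> {1..K} \<Longrightarrow> 0 \<le> \<delta> k"
  shows "0 \<le> exclusion_rate N K \<alpha> \<beta> \<delta> x y"
  unfolding exclusion_rate_def
  by (intro sum_nonneg add_nonneg_nonneg) (auto simp: assms)

text \<open>The index set of the hop sum in \<open>exclusion_rate\<close>, named so that the sum can
  be reindexed.\<close>

definition adjacent_sites :: "nat \<Rightarrow> (nat \<times> nat) set" where
  "adjacent_sites N = {(i, j). i \<in> {1..N} \<and> j \<in> {1..N} \<and> \<bar>int i - int j\<bar> = 1}"

lemma finite_adjacent_sites: "finite (adjacent_sites N)"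
  by (rule finite_subset[of _ "{1..N} \<times> {1..N}"]) (auto simp: adjacent_sites_def)

text \<open>Hops between two sites are possible in both directions; this symmetry pairs each hop
  with its reversal.\<close>

lemma swap_adjacent_sites: "prod.swap ` adjacent_sites N = adjacent_sites N"
  by (force simp: adjacent_sites_def image_iff)

text \<open>All contributions to the rate are nonnegative, so the departure term for type
  \<open>x 1\<close> at site 1 alone makes it positive.\<close>

lemma departure_rate_pos:
  assumes "\<And>k. k \<in> {1..K} \<Longrightarrow> 0 \<le> \<alpha> k" "\<And>k. k \<in> {1..K} \<Longrightarrow> 0 < \<beta> k"
    and "\<And>k. k \<in> {1..K} \<Longrightarrow> 0 \<le> \<delta> k"
    and "x 1 \<in> {1..K}"
  shows "0 < exclusion_rate N K \<alpha> \<beta> \<delta> x (x(1 := 0))"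
  unfolding exclusion_rate_def
proof (rule sum_pos2[where i = "x 1"])
  let ?y = "x(1 := 0)"
  have "0 < (\<Sum>i\<in>{1, N}. if x i = x 1 \<and> ?y = x(i := 0) then \<beta> (x 1) else 0)"
    by (rule sum_pos2[where i = 1]) (use assms in \<open>auto simp: less_imp_le\<close>)
  moreover have "0 \<le> (\<Sum>i\<in>{1, N}. if x i = 0 \<and> ?y = x(i := x 1) then \<alpha> (x 1) else 0)"
    using assms by (intro sum_nonneg) auto
  moreover have "0 \<le> (\<Sum>(i, j)\<in>adjacent_sites N.
      if x i = x 1 \<and> x j = 0 \<and> ?y = x(i := 0, j := x 1) then \<delta> (x 1) else 0)"
    using assms by (intro sum_nonneg) auto
  ultimately show "0 < (\<Sum>i\<in>{1, N}. if x i = 0 \<and> ?y = x(i := x 1) then \<alpha> (x 1) else 0)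
      + (\<Sum>i\<in>{1, N}. if x i = x 1 \<and> ?y = x(i := 0) then \<beta> (x 1) else 0)
      + (\<Sum>(i, j)\<in>{(i, j). i \<in> {1..N} \<and> j \<in> {1..N} \<and> \<bar>int i - int j\<bar> = 1}.
           if x i = x 1 \<and> x j = 0 \<and> ?y = x(i := 0, j := x 1) then \<delta> (x 1) else 0)"
    unfolding adjacent_sites_def by linarith
qed (use assms in \<open>auto intro!: add_nonneg_nonneg sum_nonneg simp: less_imp_le\<close>)

lemma hop_rate_pos:
  assumes "\<And>k. k \<in> {1..K} \<Longrightarrow> 0 \<le> \<alpha> k" "\<And>k. k \<in> {1..K} \<Longrightarrow> 0 \<le> \<beta> k"
    and "\<And>k. k \<in> {1..K} \<Longrightarrow> 0 < \<delta> k"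
    and "(i, j) \<in> adjacent_sites N" "x i \<in> {1..K}" "x j = 0"
  shows "0 < exclusion_rate N K \<alpha> \<beta> \<delta> x (x(i := 0, j := x i))"
  unfolding exclusion_rate_def adjacent_sites_def[symmetric]
proof (rule sum_pos2[where i = "x i"])
  let ?y = "x(i := 0, j := x i)"
  have "0 < (\<Sum>(i', j')\<in>adjacent_sites N.
      if x i' = x i \<and> x j' = 0 \<and> ?y = x(i' := 0, j' := x i) then \<delta> (x i) else 0)"
    by (rule sum_pos2[where i = "(i, j)"])
       (use assms in \<open>auto simp: finite_adjacent_sites less_imp_le\<close>)
  moreover have "0 \<le> (\<Sum>i'\<in>{1, N}. if x i' = 0 \<and> ?y = x(i' := x i) then \<alpha> (x i) else 0)"
    using assms by (intro sum_nonneg) auto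
  moreover have "0 \<le> (\<Sum>i'\<in>{1, N}. if x i' = x i \<and> ?y = x(i' := 0) then \<beta> (x i) else 0)"
    using assms by (intro sum_nonneg) auto
  ultimately show "0 < (\<Sum>i'\<in>{1, N}. if x i' = 0 \<and> ?y = x(i' := x i) then \<alpha> (x i) else 0)
      + (\<Sum>i'\<in>{1, N}. if x i' = x i \<and> ?y = x(i' := 0) then \<beta> (x i) else 0)
      + (\<Sum>(i', j')\<in>adjacent_sites N.
           if x i' = x i \<and> x j' = 0 \<and> ?y = x(i' := 0, j' := x i) then \<delta> (x i) else 0)"
    by linarith
qed (use assms in \<open>auto intro!: add_nonneg_nonneg sum_nonneg simp: less_imp_le\<close>)

text \<open>
  While the system is not empty, its leftmost particle can leave or hop to the left; both
  decrease the sum of the positions of the particles.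
\<close>

lemma exclusion_reaches_empty:
  assumes pos: "\<And>k. k \<in> {1..K} \<Longrightarrow> 0 < \<alpha> k" "\<And>k. k \<in> {1..K} \<Longrightarrow> 0 < \<beta> k"
      "\<And>k. k \<in> {1..K} \<Longrightarrow> 0 < \<delta> k"
    and "x \<in> exclusion_states N K"
  shows "(x, \<lambda>i\<in>{1..N}. 0) \<in> {(x, y). x \<in> exclusion_states N K \<and> y \<in> exclusion_states N K \<and>
    0 < exclusion_rate N K \<alpha> \<beta> \<delta> x y}\<^sup>*" (is "_ \<in> ?R\<^sup>*")
  using assms(4)
proof (induction "\<Sum>i\<in>{i\<in>{1..N}. x i \<noteq> 0}. i" arbitrary: x rule: less_induct)
  case less
  define occ where "occ x = {i\<in>{1..N}. x i \<noteq> (0::nat)}" for x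
  have step: "(x, \<lambda>i\<in>{1..N}. 0) \<in> ?R\<^sup>*"
    \<comment> \<open>The induction hypothesis in usable form: one possible jump that lowers the
      position sum is enough.\<close>
    if "y \<in> exclusion_states N K" "0 < exclusion_rate N K \<alpha> \<beta> \<delta> x y" "\<Sum> (occ y) < \<Sum> (occ x)" for y
    using less.hyps[of y] that less.prems
    by (intro converse_rtrancl_into_rtrancl[of x y]) (auto simp: occ_def)
  have fin: "finite (occ x)" for x by (simp add: occ_def)
  have xE: "x \<in> {1..N} \<rightarrow>\<^sub>E {0..K}" using less.prems by (simp add: exclusion_states_def)
  show ?case
  proof (cases "occ x = {}")
    case True
    \<comment> \<open>Off \<open>{1..N}\<close> both functions are \<open>undefined\<close>, so
      having no occupied site determines \<open>x\<close>.\<close>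
    then have "x = (\<lambda>i\<in>{1..N}. 0)"
      using xE by (auto simp: occ_def fun_eq_iff PiE_def extensional_def)
    then show ?thesis by simp
  next
    case False
    define i where "i = Min (occ x)"
    have i: "i \<in> occ x" using False fin by (simp add: i_def)
    then have iN: "i \<in> {1..N}" and xi: "x i \<in> {1..K}"
      using xE by (auto simp: occ_def PiE_def Pi_def Suc_le_eq)
    have rm: "\<Sum> (occ x) = i + \<Sum> (occ x - {i})"
      using sum.remove[OF fin i, of "\<lambda>i. i"] by simp
    show ?thesis
    proof (cases "i = 1")
      case True
      have "x(1 := 0) \<in> exclusion_states N K"
        using xE iN True by (auto simp: exclusion_states_def PiE_def Pi_def extensional_def)
      moreover have "0 < exclusion_rate N K \<alpha> \<beta> \<delta> x (x(1 := 0))"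
        using pos xi True by (intro departure_rate_pos) (auto simp: less_imp_le)
      moreover have "occ (x(1 := 0)) = occ x - {i}"
        using True by (auto simp: occ_def)
      ultimately show ?thesis using step rm iN by auto
    next
      case False
      let ?j = "i - 1" and ?y = "x(i := 0, i - 1 := x i)"
      have j: "?j \<in> {1..N}" "?j < i" using False iN by auto
      \<comment> \<open>By minimality of \<open>i\<close> the left neighbour is vacant, so the hop
        is allowed; it replaces \<open>i\<close> by \<open>i - 1\<close> in the position
        sum.\<close>
      then have "?j \<notin> occ x" using fin by (metis Min_le i_def not_le)
      then have xj: "x ?j = 0" using j by (simp add: occ_def)
      have "?y \<in> exclusion_states N K"
        using xE iN xi j by (auto simp: exclusion_states_def PiE_def Pi_def extensional_def)
      moreover have "0 < exclusion_rate N K \<alpha> \<beta> \<delta> x ?y"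
        using pos xi xj j iN
        by (intro hop_rate_pos) (auto simp: less_imp_le adjacent_sites_def)
      moreover have "occ ?y = insert ?j (occ x - {i})"
        using j xi by (auto simp: occ_def)
      then have "\<Sum> (occ ?y) = ?j + \<Sum> (occ x - {i})"
        using fin \<open>?j \<notin> occ x\<close> by simp
      ultimately show ?thesis using step rm j by auto
    qed
  qed
qed

section \<open>Detailed balance for weights on configurations\<close>

text \<open>Balance holds for each kind of move separately: an arrival is reversed by a departure of
  the same type at the same site, and a hop by the opposite hop, whose rate is equal.\<close>

lemma exclusion_detailed_balance:
  fixes w :: "(nat \<Rightarrow> nat) \<Rightarrow> real"
  assumes boundary: "\<And>x i k. i \<in> {1, N} \<Longrightarrow> k \<in> {1..K} \<Longrightarrow> x i = 0 \<Longrightarrow>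
      w x * \<alpha> k = w (x(i := k)) * \<beta> k"
    and hop: "\<And>x i j. (i, j) \<in> adjacent_sites N \<Longrightarrow> x j = 0 \<Longrightarrow>
      w (x(i := 0, j := x i)) = w x"
  shows "w x * exclusion_rate N K \<alpha> \<beta> \<delta> x y = w y * exclusion_rate N K \<alpha> \<beta> \<delta> y x"
proof -
  define A where "A x y k = (\<Sum>i\<in>{1, N}. if x i = 0 \<and> y = x(i := k) then \<alpha> k else 0)" for x y k
  define B where "B x y k = (\<Sum>i\<in>{1, N}. if x i = k \<and> y = x(i := 0) then \<beta> k else 0)" for x y k
  define H where "H x y k = (\<Sum>(i, j)\<in>adjacent_sites N.
    if x i = k \<and> x j = 0 \<and> y = x(i := 0, j := k) then \<delta> k else 0)" for x y k
  have rate: "exclusion_rate N K \<alpha> \<beta> \<delta> x y = (\<Sum>k\<in>{1..K}. A x y k + B x y k + H x y k)" for x y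
    by (simp add: exclusion_rate_def A_def B_def H_def adjacent_sites_def)
  have AB: "w x * A x y k = w y * B y x k" if "k \<in> {1..K}" for x y k
    unfolding A_def B_def sum_distrib_left
  proof (intro sum.cong refl)
    fix i assume i: "i \<in> {1, N}"
    have "x i = 0 \<and> y = x(i := k) \<longleftrightarrow> y i = k \<and> x = y(i := 0)" by auto
    then show "w x * (if x i = 0 \<and> y = x(i := k) then \<alpha> k else 0)
        = w y * (if y i = k \<and> x = y(i := 0) then \<beta> k else 0)"
      using boundary[OF i that, of x] by auto
  qed
  have HH: "w x * H x y k = w y * H y x k" for k
  proof -
    \<comment> \<open>Swapping the index pairs sets the hop from \<open>i\<close> to
      \<open>j\<close> against the hop from \<open>j\<close> to \<open>i\<close>.\<close>
    have "w y * H y x k = (\<Sum>(j, i)\<in>prod.swap ` adjacent_sites N.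
        w y * (if y j = k \<and> y i = 0 \<and> x = y(j := 0, i := k) then \<delta> k else 0))"
      by (simp add: H_def sum_distrib_left swap_adjacent_sites case_prod_beta)
    also have "\<dots> = (\<Sum>(i, j)\<in>adjacent_sites N.
        w y * (if y j = k \<and> y i = 0 \<and> x = y(j := 0, i := k) then \<delta> k else 0))"
      by (subst sum.reindex) (auto simp: case_prod_beta)
    also have "\<dots> = (\<Sum>(i, j)\<in>adjacent_sites N.
        w x * (if x i = k \<and> x j = 0 \<and> y = x(i := 0, j := k) then \<delta> k else 0))"
    proof (intro sum.cong refl, clarify)
      fix i j assume ij: "(i, j) \<in> adjacent_sites N"
      then have "i \<noteq> j" by (auto simp: adjacent_sites_def)
      then have "y j = k \<and> y i = 0 \<and> x = y(j := 0, i := k) \<longleftrightarrow>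
          x i = k \<and> x j = 0 \<and> y = x(i := 0, j := k)"
        by (auto simp: fun_eq_iff)
      moreover have "w y = w x" if "x i = k" "x j = 0" "y = x(i := 0, j := k)"
        using hop[OF ij, of x] that by simp
      ultimately show "w y * (if y j = k \<and> y i = 0 \<and> x = y(j := 0, i := k) then \<delta> k else 0)
          = w x * (if x i = k \<and> x j = 0 \<and> y = x(i := 0, j := k) then \<delta> k else 0)"
        by auto
    qed
    finally show ?thesis by (simp add: H_def sum_distrib_left case_prod_beta)
  qed
  show ?thesis
    unfolding rate sum_distrib_left
    \<comment> \<open>\<open>AB\<close> is needed in both directions: arrivals from \<open>x\<close>
      to \<open>y\<close> match departures back, and departures match arrivals back.\<close>
    using AB[of _ x y] AB[of _ y x] HH by (intro sum.cong) (auto simp: algebra_simps)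
qed

section \<open>The product law and its marginals\<close>

text \<open>Strict positivity makes the support all of \<open>A\<close>; the reference law in
  \<open>reversible_stationary_iff\<close> must charge every state.\<close>

lemma exists_pmf_proportional:
  fixes w :: "'a \<Rightarrow> real"
  assumes "finite A" "A \<noteq> {}" "\<And>a. a \<in> A \<Longrightarrow> 0 < w a"
  obtains p where "set_pmf p = A" "\<And>a. a \<in> A \<Longrightarrow> pmf p a = w a / sum w A"
proof -
  define f where "f a = (if a \<in> A then w a / sum w A else 0)" for a
  have pos: "0 < sum w A" using assms by (intro sum_pos) auto
  have nn: "0 \<le> f a" for a
    using assms(3) pos by (auto simp: f_def less_imp_le)
  have "(\<integral>\<^sup>+a. ennreal (f a) \<partial>count_space UNIV) = (\<Sum>a\<in>A. ennreal (f a))"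
    using \<open>finite A\<close> by (intro nn_integral_count_space') (auto simp: f_def)
  also have "\<dots> = ennreal (\<Sum>a\<in>A. f a)"
    using nn by (simp add: sum_ennreal)
  also have "(\<Sum>a\<in>A. f a) = 1"
    using pos by (simp add: f_def sum_divide_distrib[symmetric])
  finally have int: "(\<integral>\<^sup>+a. ennreal (f a) \<partial>count_space UNIV) = 1" by simp
  have pmf: "pmf (embed_pmf f) a = f a" for a
    using nn int by (rule pmf_embed_pmf)
  have "set_pmf (embed_pmf f) = A"
  proof (rule set_eqI)
    fix a
    show "a \<in> set_pmf (embed_pmf f) \<longleftrightarrow> a \<in> A"
      using assms(3)[of a] pos by (cases "a \<in> A") (auto simp: set_pmf_iff pmf f_def)
  qed
  then show thesis using that pmf by (simp add: f_def)
qed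

lemma site_prob_Pi_pmf:
  assumes "finite A" "i \<in> A"
  shows "site_prob (Pi_pmf A dflt \<mu>) i a = pmf (\<mu> i) a"
proof -
  have "pmf (\<mu> i) a = pmf (map_pmf (\<lambda>x. x i) (Pi_pmf A dflt \<mu>)) a"
    using assms by (simp add: Pi_pmf_component)
  then show ?thesis by (simp add: site_prob_def pmf_map vimage_def)
qed

theorem theorem4:
  fixes N K :: nat and \<alpha> \<beta> \<delta> :: "nat \<Rightarrow> real"
  assumes "N \<ge> 2" and "K \<ge> 1"
    and "\<And>k. k \<in> {1..K} \<Longrightarrow> \<alpha> k > 0"
    and "\<And>k. k \<in> {1..K} \<Longrightarrow> \<beta> k > 0"
    and "\<And>k. k \<in> {1..K} \<Longrightarrow> \<delta> k > 0"
  shows "(\<exists>!p. stationary_distribution (exclusion_states N K) (exclusion_rate N K \<alpha> \<beta> \<delta>) p) \<and>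
    (\<forall>p. stationary_distribution (exclusion_states N K) (exclusion_rate N K \<alpha> \<beta> \<delta>) p \<longrightarrow>
      (\<forall>x\<in>exclusion_states N K. pmf p x = (\<Prod>i\<in>{1..N}. site_prob p i (x i))))"
proof -
  \<comment> \<open>The weights are forced, up to scaling, by balance at a boundary site:
    \<open>w 0 * \<alpha> k = w k * \<beta> k\<close>.\<close>
  define w where "w k = (if k = 0 then 1 else \<alpha> k / \<beta> k)" for k
  have "0 < w k" if "k \<in> {0..K}" for k
    using assms(3,4)[of k] that by (auto simp: w_def)
  then obtain \<mu> where \<mu>: "set_pmf \<mu> = {0..K}"
    "\<And>k. k \<in> {0..K} \<Longrightarrow> pmf \<mu> k = w k / sum w {0..K}"
    by (rule exists_pmf_proportional[of "{0..K}" w, rotated 2]) auto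
  \<comment> \<open>The default \<open>undefined\<close> agrees with the extensional functions in
    \<open>exclusion_states N K\<close>, so the support is exactly that set.\<close>
  define r where "r = Pi_pmf {1..N} undefined (\<lambda>_. \<mu>)"
  have set_r: "set_pmf r = exclusion_states N K"
    by (auto simp: r_def set_Pi_pmf \<mu>(1) exclusion_states_def PiE_dflt_def PiE_def Pi_def
        extensional_def)
  have r: "pmf r x = (\<Prod>i\<in>{1..N}. pmf \<mu> (x i))" if "x \<in> exclusion_states N K" for x
    using that by (auto simp: r_def exclusion_states_def PiE_def extensional_def intro!: pmf_Pi')
  \<comment> \<open>The product formula on all functions, since
    \<open>exclusion_detailed_balance\<close> asks for its identities without restricting
    \<open>x\<close> to the state space.\<close>
  define W where "W x = (\<Prod>i\<in>{1..N}. pmf \<mu> (x i))" for x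
  have W_upd: "W (x(i := k)) = pmf \<mu> k * (\<Prod>j\<in>{1..N} - {i}. pmf \<mu> (x j))" if "i \<in> {1..N}" for x i k
    unfolding W_def using that by (subst prod.remove[of _ i]) auto
  have balance: "W x * exclusion_rate N K \<alpha> \<beta> \<delta> x y = W y * exclusion_rate N K \<alpha> \<beta> \<delta> y x" for x y
  proof (rule exclusion_detailed_balance)
    fix x :: "nat \<Rightarrow> nat" and i k
    assume i: "i \<in> {1, N}" and k: "k \<in> {1..K}" and "x i = 0"
    \<comment> \<open>Written as an update, \<open>W x\<close> shares with
      \<open>W (x(i := k))\<close> the factor coming from the other sites.\<close>
    then have "W x = W (x(i := 0))" by (metis fun_upd_triv)
    moreover have "i \<in> {1..N}" using i \<open>N \<ge> 2\<close> by auto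
    moreover have "pmf \<mu> 0 * \<alpha> k = pmf \<mu> k * \<beta> k"
      using k assms(4)[OF k] \<mu>(2)[of k] \<mu>(2)[of 0] by (simp add: w_def)
    ultimately show "W x * \<alpha> k = W (x(i := k)) * \<beta> k"
      by (simp add: W_upd)
  next
    fix x :: "nat \<Rightarrow> nat" and i j
    assume ij: "(i, j) \<in> adjacent_sites N" and "x j = 0"
    then have *: "i \<in> {1..N}" "j \<in> {1..N}" "i \<noteq> j" by (auto simp: adjacent_sites_def)
    \<comment> \<open>With \<open>x j = 0\<close> a hop exchanges the values at \<open>i\<close> and
      \<open>j\<close>; as all sites carry the same law \<open>\<mu>\<close>, this only reorders the
      product.\<close>
    have "W (x(i := 0, j := x i)) = W (x \<circ> Transposition.transpose i j)"
      using \<open>x j = 0\<close> * by (intro arg_cong[of _ _ W]) (auto simp: fun_eq_iff Transposition.transpose_def)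
    also have "\<dots> = W x"
      unfolding W_def comp_def
      by (rule prod.reindex_bij_betw) (use * in \<open>simp add: bij_betw_transpose_iff\<close>)
    finally show "W (x(i := 0, j := x i)) = W x" .
  qed
  have stat: "stationary_distribution (exclusion_states N K) (exclusion_rate N K \<alpha> \<beta> \<delta>) p \<longleftrightarrow> p = r"
    for p
  proof (rule reversible_stationary_iff)
    show "(x, \<lambda>i\<in>{1..N}. 0) \<in> {(x, y). x \<in> exclusion_states N K \<and> y \<in> exclusion_states N K \<and>
        0 < exclusion_rate N K \<alpha> \<beta> \<delta> x y}\<^sup>*" if "x \<in> exclusion_states N K" for x
      using assms(3-5) that by (rule exclusion_reaches_empty)
    show "0 \<le> exclusion_rate N K \<alpha> \<beta> \<delta> x y" for x y
      using assms(3-5) by (intro exclusion_rate_nonneg) (auto simp: less_imp_le)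
    show "pmf r x * exclusion_rate N K \<alpha> \<beta> \<delta> x y = pmf r y * exclusion_rate N K \<alpha> \<beta> \<delta> y x"
      if "x \<in> exclusion_states N K" "y \<in> exclusion_states N K" for x y
      using balance[of x y] that by (simp only: r W_def)
  qed (rule finite_exclusion_states set_r)+
  moreover have "pmf r x = (\<Prod>i\<in>{1..N}. site_prob r i (x i))" if "x \<in> exclusion_states N K" for x
    using r[OF that] unfolding r_def by (simp add: site_prob_Pi_pmf)
  ultimately show ?thesis by auto
qed

end
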